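(* Fix $\sigma\in\{231,312\}$ and a real number $q>0$. For each $n\ge1$ let $\Pi_n$ be a random involution of $\{1,\dots,n\}$ avoiding $\sigma$, distributed according to $\mathbb{P}^{q,\sigma}_n$. Then, as $n\to\infty$, $$\frac{\mathrm{fp}(\Pi_n)-\frac{q}{\sqrt{q^2+8}}\,n}{\sqrt{\frac{8q}{(8+q^2)^{3/2}}\,n}}\to_d Z,$$ where $Z$ has a standard normal distribution.
   Context: Let $[n]=\{1,\dots,n\}$. A permutation $\pi$ of $[n]$ contains a permutation $\sigma$ of $[m]$ if there exist indices $i_1<\dots<i_m$ in $[n]$ such that for all $j<l$ in $[m]$, $\pi(i_j)<\pi(i_l)$ if and only if $\sigma(j)<\sigma(l)$; $\pi$ avoids $\sigma$ if it does not contain $\sigma$. Permutations such as $231$ are written in one-line notation. Let $I_n(\sigma)$ be the set of involutions of $[n]$ (permutations $\pi$ with $\pi\circ\pi=\mathrm{id}$) that avoid $\sigma$. For a permutation $\pi$, $\mathrm{fp}(\pi)$ is its number of fixed points. For $q\in(0,\infty)$, $\mathbb{P}^{q,\sigma}_n$ is the probability measure on $I_n(\sigma)$ with $\mathbb{P}^{q,\sigma}_n(\pi)\propto q^{\mathrm{fp}(\pi)}$, i.e. $\mathbb{P}^{q,\sigma}_n(\pi)=q^{\mathrm{fp}(\pi)}/\sum_{\tau\in I_n(\sigma)}q^{\mathrm{fp}(\tau)}$. The symbol $\to_d$ denotes convergence in distribution. *)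

theory Defs
  imports "HOL-Probability.Probability" "HOL-Combinatorics.Permutations"
begin

text \<open>Permutations of \<open>{1..n}\<close> are functions \<open>\<pi> :: nat \<Rightarrow> nat\<close> with \<^term>\<open>\<pi> permutes {1..n}\<close>;
  in particular they are the identity outside \<open>{1..n}\<close>.\<close>

text \<open>The permutation with one-line notation \<open>xs\<close>; meaningful if \<open>xs\<close> is a rearrangement of
  \<open>[1, \<dots>, length xs]\<close>. Positions and values are both counted from 1.\<close>

definition one_line :: "nat list \<Rightarrow> nat \<Rightarrow> nat" where
  "one_line xs i = (if i \<in> {1..length xs} then xs ! (i - 1) else i)"

definition contains_pattern :: "nat \<Rightarrow> (nat \<Rightarrow> nat) \<Rightarrow> nat \<Rightarrow> (nat \<Rightarrow> nat) \<Rightarrow> bool" where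
  "contains_pattern n \<pi> m \<sigma> \<longleftrightarrow>
     (\<exists>i. strict_mono_on {1..m} i \<and> i ` {1..m} \<subseteq> {1..n} \<and>
          (\<forall>j\<in>{1..m}. \<forall>l\<in>{1..m}. j < l \<longrightarrow> (\<pi> (i j) < \<pi> (i l) \<longleftrightarrow> \<sigma> j < \<sigma> l)))"

definition avoiding_involutions :: "nat \<Rightarrow> nat \<Rightarrow> (nat \<Rightarrow> nat) \<Rightarrow> (nat \<Rightarrow> nat) set" where
  "avoiding_involutions n m \<sigma> =
     {\<pi>. \<pi> permutes {1..n} \<and> \<pi> \<circ> \<pi> = id \<and> \<not> contains_pattern n \<pi> m \<sigma>}"

text \<open>Only points of \<open>{1..n}\<close> are counted, since \<open>\<pi>\<close> fixes every number outside \<open>{1..n}\<close>.\<close>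

definition fp :: "nat \<Rightarrow> (nat \<Rightarrow> nat) \<Rightarrow> nat" where
  "fp n \<pi> = card {i \<in> {1..n}. \<pi> i = i}"

definition involution_measure ::
    "real \<Rightarrow> nat \<Rightarrow> nat \<Rightarrow> (nat \<Rightarrow> nat) \<Rightarrow> (nat \<Rightarrow> nat) measure" where
  "involution_measure q n m \<sigma> =
     point_measure (avoiding_involutions n m \<sigma>)
       (\<lambda>\<pi>. ennreal (q ^ fp n \<pi> / (\<Sum>\<tau>\<in>avoiding_involutions n m \<sigma>. q ^ fp n \<tau>)))"

lemma one_line_231_permutes: "one_line [2, 3, 1] permutes {1..3}"
proof (rule bij_imp_permutes)
  have *: "{1..3::nat} = {1, 2, 3}" by auto
  show "bij_betw (one_line [2, 3, 1]) {1..3} {1..3}"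
    unfolding * by (auto simp: bij_betw_def inj_on_def one_line_def)
qed (auto simp: one_line_def)

lemma one_line_312_permutes: "one_line [3, 1, 2] permutes {1..3}"
proof (rule bij_imp_permutes)
  have *: "{1..3::nat} = {1, 2, 3}" by auto
  show "bij_betw (one_line [3, 1, 2]) {1..3} {1..3}"
    unfolding * by (auto simp: bij_betw_def inj_on_def one_line_def)
qed (auto simp: one_line_def)

lemma finite_avoiding_involutions: "finite (avoiding_involutions n m \<sigma>)"
  by (rule finite_subset[OF _ finite_permutations[of "{1..n}"]])
     (auto simp: avoiding_involutions_def)

lemma id_in_avoiding_involutions:
  assumes "j \<in> {1..m}" "l \<in> {1..m}" "j < l" "\<sigma> l \<le> \<sigma> j"
  shows "id \<in> avoiding_involutions n m \<sigma>"
proof -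
  have "\<not> contains_pattern n id m \<sigma>"
  proof
    assume "contains_pattern n id m \<sigma>"
    then obtain i :: "nat \<Rightarrow> nat" where mono: "strict_mono_on {1..m} i"
      and iff: "\<forall>j\<in>{1..m}. \<forall>l\<in>{1..m}. j < l \<longrightarrow> (id (i j) < id (i l) \<longleftrightarrow> \<sigma> j < \<sigma> l)"
      unfolding contains_pattern_def by blast
    have "i j < i l"
      using strict_mono_onD[OF mono assms(1,2,3)] .
    moreover have "i j < i l \<longleftrightarrow> \<sigma> j < \<sigma> l"
      using iff[rule_format, OF assms(1,2,3)] by simp
    ultimately show False
      using assms(4) by simp
  qed
  then show ?thesis
    by (simp add: avoiding_involutions_def permutes_id)
qed

lemma prob_space_involution_measure:
  assumes "q > 0" and ne: "avoiding_involutions n m \<sigma> \<noteq> {}"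
  shows "prob_space (involution_measure q n m \<sigma>)"
proof
  let ?A = "avoiding_involutions n m \<sigma>"
  let ?S = "\<Sum>\<tau>\<in>?A. q ^ fp n \<tau>"
  have fin: "finite ?A" by (rule finite_avoiding_involutions)
  have S: "?S > 0" by (rule sum_pos[OF fin ne]) (use assms(1) in simp)
  have "emeasure (involution_measure q n m \<sigma>) ?A = (\<Sum>\<pi>\<in>?A. ennreal (q ^ fp n \<pi> / ?S))"
    unfolding involution_measure_def by (rule emeasure_point_measure_finite[OF fin order_refl])
  also have "\<dots> = ennreal (\<Sum>\<pi>\<in>?A. q ^ fp n \<pi> / ?S)"
    by (rule sum_ennreal) (intro divide_nonneg_pos[OF _ S] zero_le_power, use assms(1) in simp)
  also have "(\<Sum>\<pi>\<in>?A. q ^ fp n \<pi> / ?S) = 1"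
    using S unfolding sum_divide_distrib[symmetric] by (rule divide_self[OF less_imp_neq[THEN not_sym]])
  finally show "emeasure (involution_measure q n m \<sigma>) (space (involution_measure q n m \<sigma>)) = 1"
    by (simp add: involution_measure_def space_point_measure)
qed

end

theory Submission
  imports Defs "HOL-Real_Asymp.Real_Asymp"
begin

text \<open>
  An involution contains 231 exactly when it contains 312, so both choices of \<open>\<sigma>\<close> give the same
  set of involutions. Such an involution is layered: if \<open>k = \<pi> n\<close>, avoidance forces \<open>\<pi>\<close> to reverse the
  interval \<open>{k..n}\<close> (lemma \<open>invols_231_last_block\<close>), and what remains is an arbitrary avoiding
  involution of \<open>{1..k-1}\<close>. A reversed block has a fixed point exactly if its length is odd, and
  then only one. Hence the polynomials \<open>P n w = (\<Sum>\<pi>. w ^ fp n \<pi>)\<close> count compositions of \<open>n\<close> with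
  weight \<open>w\<close> for each odd part, and satisfy \<open>P (n + 2) w = w * P (n + 1) w + 2 * P n w\<close>
  (lemma \<open>fp_poly_rec\<close>).

  The characteristic function of the number of fixed points at \<open>\<theta>\<close> is the quotient
  \<open>P n (q * exp (\<i> * \<theta>)) / P n q\<close>. For \<open>w\<close> near \<open>q\<close> the root \<open>\<lambda> w = (w + sqrt (w\<^sup>2 + 8)) / 2\<close> of the
  characteristic polynomial \<open>x\<^sup>2 - w * x - 2\<close> has strictly larger modulus than the other one, so
  \<open>P n w\<close> is asymptotic to \<open>C w * \<lambda> w ^ n\<close>, where \<open>C\<close> is continuous and nonzero at \<open>q\<close>
  (lemma \<open>fp_poly_asymptotics\<close>). Therefore, when \<open>\<theta>\<close> tends to 0 with \<open>n\<close>, the quotient behaves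
  like \<open>exp (n * (Ln (\<lambda> (q * exp (\<i> * \<theta>))) - Ln (\<lambda> q)))\<close>.

  The first two derivatives of \<open>Ln (\<lambda> (q * exp z))\<close> at \<open>z = 0\<close> are \<open>q / sqrt (q\<^sup>2 + 8)\<close> and
  \<open>8 * q / (q\<^sup>2 + 8) powr (3 / 2)\<close>, which are the coefficients of \<open>n\<close> in the centring and under the
  root of the normalisation. With \<open>\<theta>\<close> equal to \<open>s\<close> divided by the normalisation, a second order expansion shows that after centring the
  quotient tends to \<open>exp (- s\<^sup>2 / 2)\<close> (lemmas \<open>dominant_root_power_gaussian_limit\<close> and
  \<open>fp_char_limit\<close>), and Levy's continuity theorem turns this into convergence in distribution.
\<close>

section \<open>Involutions avoiding 231 or 312\<close>

lemma involution_permutes: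
  assumes "\<And>i. f (f i) = i" "\<And>i. i \<notin> S \<Longrightarrow> f i = i"
  shows "f permutes S"
  unfolding permutes_def by (metis assms)

lemma atLeastAtMost_1_3: "{1..3::nat} = {1, 2, 3}"
  by auto

lemma contains_pattern_3_iff:
  "contains_pattern n \<pi> 3 \<sigma> \<longleftrightarrow>
     (\<exists>a b c. 1 \<le> a \<and> a < b \<and> b < c \<and> c \<le> n \<and>
        (\<pi> a < \<pi> b \<longleftrightarrow> \<sigma> 1 < \<sigma> 2) \<and> (\<pi> a < \<pi> c \<longleftrightarrow> \<sigma> 1 < \<sigma> 3) \<and> (\<pi> b < \<pi> c \<longleftrightarrow> \<sigma> 2 < \<sigma> 3))"
    (is "?L \<longleftrightarrow> ?R")
proof
  assume ?L
  then obtain i :: "nat \<Rightarrow> nat" where i: "strict_mono_on {1..3} i" "i ` {1..3} \<subseteq> {1..n}"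
    and iff: "\<forall>j\<in>{1..3}. \<forall>l\<in>{1..3}. j < l \<longrightarrow> (\<pi> (i j) < \<pi> (i l) \<longleftrightarrow> \<sigma> j < \<sigma> l)"
    unfolding contains_pattern_def by blast
  have "i 1 < i 2" "i 2 < i 3"
    using strict_mono_onD[OF i(1), of 1 2] strict_mono_onD[OF i(1), of 2 3] by simp_all
  moreover have "1 \<le> i 1" "i 3 \<le> n" using i(2) by (simp_all add: image_subset_iff)
  ultimately show ?R using iff
    by (intro exI[of _ "i 1"] exI[of _ "i 2"] exI[of _ "i 3"]) (auto simp: atLeastAtMost_1_3)
next
  assume ?R
  then obtain a b c where abc: "1 \<le> a" "a < b" "b < c" "c \<le> n"
    "\<pi> a < \<pi> b \<longleftrightarrow> \<sigma> 1 < \<sigma> 2" "\<pi> a < \<pi> c \<longleftrightarrow> \<sigma> 1 < \<sigma> 3" "\<pi> b < \<pi> c \<longleftrightarrow> \<sigma> 2 < \<sigma> 3"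
    by blast
  define i :: "nat \<Rightarrow> nat" where "i j = (if j = 1 then a else if j = 2 then b else c)" for j
  show ?L
    unfolding contains_pattern_def atLeastAtMost_1_3
    by (rule exI[of _ i]) (use abc in \<open>auto simp: i_def strict_mono_on_def\<close>)
qed

definition avoids_231 :: "nat \<Rightarrow> (nat \<Rightarrow> nat) \<Rightarrow> bool" where
  "avoids_231 n \<pi> \<longleftrightarrow>
     \<not> (\<exists>a b c. 1 \<le> a \<and> a < b \<and> b < c \<and> c \<le> n \<and> \<pi> c < \<pi> a \<and> \<pi> a < \<pi> b)"

definition invols_231 :: "nat \<Rightarrow> (nat \<Rightarrow> nat) set" where
  "invols_231 n = {\<pi>. \<pi> permutes {1..n} \<and> \<pi> \<circ> \<pi> = id \<and> avoids_231 n \<pi>}"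

lemma contains_231_iff:
  assumes "inj \<pi>"
  shows "contains_pattern n \<pi> 3 (one_line [2, 3, 1]) \<longleftrightarrow> \<not> avoids_231 n \<pi>"
proof -
  have "(\<pi> a < \<pi> b \<and> \<not> \<pi> a < \<pi> c \<and> \<not> \<pi> b < \<pi> c) \<longleftrightarrow> (\<pi> c < \<pi> a \<and> \<pi> a < \<pi> b)" if "a < b" "b < c" for a b c
    using injD[OF assms, of a c] that by fastforce
  then show ?thesis
    unfolding contains_pattern_3_iff avoids_231_def not_not
    by (simp add: one_line_def cong: conj_cong)
qed

text \<open>The inverse of 231 is 312, and an involution is its own inverse: the occurrence of one pattern at
  positions \<open>a < b < c\<close> becomes an occurrence of the other whose positions are the values
  taken at \<open>a\<close>, \<open>b\<close>, \<open>c\<close>.\<close>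

lemma contains_312_iff:
  assumes "\<pi> permutes {1..n}" "\<pi> \<circ> \<pi> = id"
  shows "contains_pattern n \<pi> 3 (one_line [3, 1, 2]) \<longleftrightarrow> \<not> avoids_231 n \<pi>"
proof -
  have inj: "inj \<pi>" using assms(1) by (rule permutes_inj)
  have pp: "\<pi> (\<pi> i) = i" for i using assms(2) by (simp add: fun_eq_iff)
  have rng: "\<pi> i \<in> {1..n} \<longleftrightarrow> i \<in> {1..n}" for i using permutes_in_image[OF assms(1)] .
  have "contains_pattern n \<pi> 3 (one_line [3, 1, 2]) \<longleftrightarrow>
      (\<exists>a b c. 1 \<le> a \<and> a < b \<and> b < c \<and> c \<le> n \<and> \<pi> b < \<pi> c \<and> \<pi> c < \<pi> a)"
  proof -
    have "(\<not> \<pi> a < \<pi> b \<and> \<not> \<pi> a < \<pi> c \<and> \<pi> b < \<pi> c) \<longleftrightarrow> (\<pi> b < \<pi> c \<and> \<pi> c < \<pi> a)" if "a < b" "b < c" for a b c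
      using injD[OF inj, of a c] that by fastforce
    then show ?thesis
      unfolding contains_pattern_3_iff by (simp add: one_line_def cong: conj_cong)
  qed
  also have "\<dots> \<longleftrightarrow> (\<exists>a b c. 1 \<le> a \<and> a < b \<and> b < c \<and> c \<le> n \<and> \<pi> c < \<pi> a \<and> \<pi> a < \<pi> b)"
  proof safe
    fix a b c assume *: "1 \<le> a" "a < b" "b < c" "c \<le> n" "\<pi> b < \<pi> c" "\<pi> c < \<pi> a"
    show "\<exists>a b c. 1 \<le> a \<and> a < b \<and> b < c \<and> c \<le> n \<and> \<pi> c < \<pi> a \<and> \<pi> a < \<pi> b"
      using * rng[of a] rng[of b]
      by (intro exI[of _ "\<pi> b"] exI[of _ "\<pi> c"] exI[of _ "\<pi> a"]) (auto simp: pp)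
  next
    fix a b c assume *: "1 \<le> a" "a < b" "b < c" "c \<le> n" "\<pi> c < \<pi> a" "\<pi> a < \<pi> b"
    show "\<exists>a b c. 1 \<le> a \<and> a < b \<and> b < c \<and> c \<le> n \<and> \<pi> b < \<pi> c \<and> \<pi> c < \<pi> a"
      using * rng[of b] rng[of c]
      by (intro exI[of _ "\<pi> c"] exI[of _ "\<pi> a"] exI[of _ "\<pi> b"]) (auto simp: pp)
  qed
  finally show ?thesis by (simp only: avoids_231_def not_not)
qed

lemma avoiding_involutions_eq_invols_231:
  assumes "\<sigma> \<in> {one_line [2, 3, 1], one_line [3, 1, 2]}"
  shows "avoiding_involutions n 3 \<sigma> = invols_231 n"
  using assms contains_231_iff[OF permutes_inj] contains_312_iff
  unfolding avoiding_involutions_def invols_231_def by blast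

section \<open>Splitting off the last reversed block\<close>

text \<open>The direct sum of a permutation \<open>\<pi>\<close> of \<open>{1..k-1}\<close> and a decreasing permutation of
  length \<open>n + 1 - k\<close>.\<close>

definition append_reversal :: "nat \<Rightarrow> nat \<Rightarrow> (nat \<Rightarrow> nat) \<Rightarrow> nat \<Rightarrow> nat" where
  "append_reversal n k \<pi> i = (if i \<in> {k..n} then n + k - i else \<pi> i)"

text \<open>The pattern 231 does not arise across blocks: all values of the reversal exceed those of
  \<open>\<pi>\<close>, so an occurrence whose first entry lies in the reversal is contained in that
  decreasing block, and otherwise its smallest entry, the last one, already lies in
  \<open>{1..k-1}\<close>, with the other two before it.\<close>

lemma append_reversal_in_invols_231:
  assumes "\<pi> \<in> invols_231 (k - 1)" "k \<in> {1..n}"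
  shows "append_reversal n k \<pi> \<in> invols_231 n"
proof -
  let ?\<rho> = "append_reversal n k \<pi>"
  have perm: "\<pi> permutes {1..k-1}" and inv: "\<pi> \<circ> \<pi> = id" and av: "avoids_231 (k - 1) \<pi>"
    using assms by (auto simp: invols_231_def)
  have pp: "\<pi> (\<pi> i) = i" for i using inv by (simp add: fun_eq_iff)
  have rng: "\<pi> i \<in> {1..k-1} \<longleftrightarrow> i \<in> {1..k-1}" for i using permutes_in_image[OF perm] .
  have out: "\<pi> i = i" if "i \<notin> {1..k-1}" for i using permutes_not_in[OF perm that] .
  have lt: "\<pi> i < k" "1 \<le> \<pi> i" if "1 \<le> i" "i < k" for i using rng[of i] that assms(2) by auto
  have hi: "?\<rho> i = n + k - i" if "k \<le> i" "i \<le> n" for i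
    using that by (simp add: append_reversal_def)
  have lo: "?\<rho> i = \<pi> i" if "i < k" for i using that by (simp add: append_reversal_def)
  have rr: "?\<rho> (?\<rho> i) = i" for i
  proof (cases "i \<in> {k..n}")
    case True then show ?thesis by (auto simp: append_reversal_def)
  next
    case False
    then have "\<pi> i \<notin> {k..n}" using lt[of i] out[of i] assms(2) by (cases "i \<in> {1..k-1}") auto
    with False show ?thesis by (auto simp: append_reversal_def pp)
  qed
  have "?\<rho> permutes {1..n}"
  proof (rule involution_permutes)
    fix i assume "i \<notin> {1..n}" then show "?\<rho> i = i"
      using assms(2) out[of i] by (auto simp: append_reversal_def)
  next
    show "?\<rho> (?\<rho> i) = i" for i by (rule rr)
  qed
  moreover have "?\<rho> \<circ> ?\<rho> = id" by (simp add: fun_eq_iff rr)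
  moreover have "avoids_231 n ?\<rho>"
    unfolding avoids_231_def
  proof safe
    fix a b c assume abc: "1 \<le> a" "a < b" "b < c" "c \<le> n" "?\<rho> c < ?\<rho> a" "?\<rho> a < ?\<rho> b"
    have "a < k"
    proof (rule ccontr)
      assume "\<not> a < k" then show False using abc hi[of a] hi[of b] by simp
    qed
    moreover from this have "c < k"
    proof -
      have "?\<rho> c < k" using abc(1,5) lo[of a] lt[of a] \<open>a < k\<close> by simp
      with hi[of c] abc(4) show ?thesis by (cases "c < k") auto
    qed
    ultimately have "1 \<le> a \<and> a < b \<and> b < c \<and> c \<le> k - 1 \<and> \<pi> c < \<pi> a \<and> \<pi> a < \<pi> b"
      using abc lo by simp
    with av show False unfolding avoids_231_def by blast
  qed
  ultimately show ?thesis by (simp add: invols_231_def)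
qed

text \<open>Along a decreasing sequence of integers \<open>\<pi> i + i\<close> is weakly decreasing. Its values at the two
  ends are both squeezed to \<open>n + k\<close> by the bounds on \<open>\<pi>\<close>.\<close>

lemma decreasing_perm_interval:
  fixes \<pi> :: "nat \<Rightarrow> nat"
  assumes "\<And>i j. k \<le> i \<Longrightarrow> i < j \<Longrightarrow> j \<le> n \<Longrightarrow> \<pi> j < \<pi> i"
    and "\<pi> ` {k..n} \<subseteq> {k..n}" "k \<le> i" "i \<le> n"
  shows "\<pi> i = n + k - i"
proof -
  have "\<pi> i + i \<le> \<pi> k + k"
    using assms(3,4)
  proof (induction i rule: dec_induct)
    case (step i)
    then show ?case using assms(1)[of i "Suc i"] by simp
  qed simp
  moreover have "\<pi> n + n \<le> \<pi> i + i"
    using assms(4,3)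
  proof (induction i rule: inc_induct)
    case (step i)
    then show ?case using assms(1)[of i "Suc i"] by simp
  qed simp
  moreover have "\<pi> k \<le> n" "k \<le> \<pi> n" using assms(2-4) by (auto simp: image_subset_iff)
  ultimately show ?thesis by linarith
qed

text \<open>Let \<open>k = \<pi> n\<close>, so that \<open>\<pi> k = n\<close>. A position \<open>i < k\<close> with a value above \<open>k\<close> would form
  the pattern 231 with the positions \<open>k\<close> and \<open>n\<close>, whose values are \<open>n\<close> and \<open>k\<close>. Hence \<open>\<pi>\<close>
  preserves \<open>{1..k-1}\<close> and \<open>{k..n}\<close>. On the latter it is decreasing, since an ascent followed
  by the minimal value \<open>k\<close> at position \<open>n\<close> is again a 231.\<close>

lemma invols_231_last_block:
  assumes "\<pi> \<in> invols_231 n" "n \<ge> 1"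
  shows "\<pi> n \<in> {1..n}" "\<And>i. \<pi> n \<le> i \<Longrightarrow> i \<le> n \<Longrightarrow> \<pi> i = n + \<pi> n - i"
    "\<And>i. 1 \<le> i \<Longrightarrow> i < \<pi> n \<Longrightarrow> \<pi> i < \<pi> n"
proof -
  define k where "k = \<pi> n"
  have perm: "\<pi> permutes {1..n}" and inv: "\<pi> \<circ> \<pi> = id" and av: "avoids_231 n \<pi>"
    using assms by (auto simp: invols_231_def)
  have pp: "\<pi> (\<pi> i) = i" for i using inv by (simp add: fun_eq_iff)
  have eq: "\<pi> i = \<pi> j \<longleftrightarrow> i = j" for i j by (metis pp)
  have rng: "\<pi> i \<in> {1..n} \<longleftrightarrow> i \<in> {1..n}" for i using permutes_in_image[OF perm] .
  have kn: "k \<in> {1..n}" using rng[of n] assms(2) by (simp add: k_def)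
  have pn: "\<pi> n = k" by (simp add: k_def)
  have pk: "\<pi> k = n" by (simp add: k_def pp)
  have no: False if "1 \<le> a" "a < b" "b < c" "c \<le> n" "\<pi> c < \<pi> a" "\<pi> a < \<pi> b" for a b c
    using av that unfolding avoids_231_def by blast
  have low: "\<pi> i < k" if "1 \<le> i" "i < k" for i
  proof (rule ccontr)
    assume "\<not> \<pi> i < k"
    moreover have "\<pi> i \<noteq> k" "\<pi> i \<noteq> n" using eq[of i n] eq[of i k] that kn pn pk by auto
    moreover have "\<pi> i \<le> n" using rng[of i] that kn by simp
    ultimately have "k < \<pi> i" "\<pi> i < n" by simp_all
    then show False using no[of i k n] that pn pk by simp
  qed
  have high: "\<pi> i \<in> {k..n}" if "k \<le> i" "i \<le> n" for i
    using low[of "\<pi> i"] rng[of i] that kn by (auto simp: pp not_less[symmetric])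
  have dec: "\<pi> j < \<pi> i" if "k \<le> i" "i < j" "j \<le> n" for i j
  proof (rule ccontr)
    assume "\<not> \<pi> j < \<pi> i"
    with eq[of i j] that have *: "\<pi> i < \<pi> j" by auto
    have "k < \<pi> i" using high[of i] eq[of i n] that pn by (simp add: order_less_le)
    moreover from this * pn have "j \<noteq> n" by auto
    ultimately show False using * no[of i j n] that kn pn by simp
  qed
  show "\<pi> n \<in> {1..n}" using kn by (simp add: k_def)
  show "\<pi> i = n + \<pi> n - i" if "\<pi> n \<le> i" "i \<le> n" for i
    unfolding k_def[symmetric]
    by (rule decreasing_perm_interval) (use dec high that in \<open>auto simp: k_def\<close>)
  show "\<pi> i < \<pi> n" if "1 \<le> i" "i < \<pi> n" for i
    using low that by (simp add: k_def)
qed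

lemma remove_last_block_in_invols_231:
  assumes "\<pi> \<in> invols_231 n" "n \<ge> 1"
  shows "(\<lambda>i. if i \<in> {\<pi> n..n} then i else \<pi> i) \<in> invols_231 (\<pi> n - 1)"
proof -
  let ?\<rho> = "\<lambda>i. if i \<in> {\<pi> n..n} then i else \<pi> i"
  note blk = invols_231_last_block[OF assms]
  have perm: "\<pi> permutes {1..n}" and inv: "\<pi> \<circ> \<pi> = id" and av: "avoids_231 n \<pi>"
    using assms by (auto simp: invols_231_def)
  have pp: "\<pi> (\<pi> i) = i" for i using inv by (simp add: fun_eq_iff)
  have out: "\<pi> i = i" if "i \<notin> {1..n}" for i using permutes_not_in[OF perm that] .
  have rr: "?\<rho> (?\<rho> i) = i" for i
    using blk(1) blk(3)[of i] out[of i] pp[of i] by (cases "i \<in> {1..<\<pi> n}") auto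
  have "?\<rho> permutes {1..\<pi> n - 1}"
  proof (rule involution_permutes)
    fix i assume "i \<notin> {1..\<pi> n - 1}" then show "?\<rho> i = i"
      using blk(1) out[of i] by auto
  next
    show "?\<rho> (?\<rho> i) = i" for i by (rule rr)
  qed
  moreover have "?\<rho> \<circ> ?\<rho> = id" using rr by (simp only: fun_eq_iff o_apply id_apply)  simp
  moreover have "avoids_231 (\<pi> n - 1) ?\<rho>"
    unfolding avoids_231_def
  proof safe
    fix a b c assume abc: "1 \<le> a" "a < b" "b < c" "c \<le> \<pi> n - 1" "?\<rho> c < ?\<rho> a" "?\<rho> a < ?\<rho> b"
    then have "c < \<pi> n" by simp
    then have "\<pi> c < \<pi> a" "\<pi> a < \<pi> b" "c \<le> n" using abc blk(1) by auto
    with abc av show False unfolding avoids_231_def by blast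
  qed
  ultimately show ?thesis by (simp add: invols_231_def)
qed

lemma append_reversal_last_block:
  assumes "\<pi> \<in> invols_231 n" "n \<ge> 1"
  shows "append_reversal n (\<pi> n) (\<lambda>i. if i \<in> {\<pi> n..n} then i else \<pi> i) = \<pi>"
proof
  fix i
  show "append_reversal n (\<pi> n) (\<lambda>i. if i \<in> {\<pi> n..n} then i else \<pi> i) i = \<pi> i"
    using invols_231_last_block(2)[OF assms, of i]
    by (auto simp: append_reversal_def)
qed

lemma fp_append_reversal:
  assumes "k \<in> {1..n}"
  shows "fp n (append_reversal n k \<pi>) = fp (k - 1) \<pi> + (if even (n + k) then 1 else 0)"
proof -
  have "{i \<in> {1..n}. append_reversal n k \<pi> i = i} =
      {i \<in> {1..k-1}. \<pi> i = i} \<union> {i \<in> {k..n}. n + k = 2 * i}"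
    using assms by (auto simp: append_reversal_def split: if_splits)
  moreover have "card {i \<in> {k..n}. n + k = 2 * i} = (if even (n + k) then 1 else 0)"
  proof (cases "even (n + k)")
    case True
    then obtain m where "n + k = 2 * m" by (rule evenE)
    then have "{i \<in> {k..n}. n + k = 2 * i} = {m}" using assms by auto
    with True show ?thesis by simp
  next
    case False
    then have "{i \<in> {k..n}. n + k = 2 * i} = {}" by (auto dest: arg_cong[of _ _ even])
    then show ?thesis using False by (simp only: card.empty if_False)
  qed
  moreover have "{i \<in> {1..k-1}. \<pi> i = i} \<inter> {i \<in> {k..n}. n + k = 2 * i} = {}"
    using assms by auto
  ultimately show ?thesis
    unfolding fp_def by (simp add: card_Un_disjoint)
qed

section \<open>The fixed point polynomial\<close>

definition fp_poly :: "nat \<Rightarrow> complex \<Rightarrow> complex" where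
  "fp_poly n w = (\<Sum>\<pi>\<in>invols_231 n. w ^ fp n \<pi>)"

lemma finite_invols_231: "finite (invols_231 n)"
  by (rule finite_subset[OF _ finite_permutations[of "{1..n}"]]) (auto simp: invols_231_def)

text \<open>Summation over the position \<open>k\<close> at which the last block starts; this block has a fixed point,
  its midpoint, exactly if \<open>n + k\<close> is even.\<close>

lemma fp_poly_last_block:
  assumes "n \<ge> 1"
  shows "fp_poly n w = (\<Sum>k\<in>{1..n}. (if even (n + k) then w else 1) * fp_poly (k - 1) w)"
proof -
  have "fp_poly n w =
      (\<Sum>(k, \<pi>)\<in>(SIGMA k:{1..n}. invols_231 (k - 1)). w ^ fp n (append_reversal n k \<pi>))"
    unfolding fp_poly_def
  proof (rule sum.reindex_bij_witness[where i = "\<lambda>(k, \<pi>). append_reversal n k \<pi>"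
        and j = "\<lambda>\<pi>. (\<pi> n, \<lambda>i. if i \<in> {\<pi> n..n} then i else \<pi> i)"], goal_cases)
    case (1 \<pi>)
    then show ?case using append_reversal_last_block[OF 1 assms] by simp
  next
    case (2 \<pi>)
    then show ?case
      using remove_last_block_in_invols_231[OF 2 assms] invols_231_last_block(1)[OF 2 assms] by simp
  next
    case (3 x)
    then obtain k \<pi> where x: "x = (k, \<pi>)" "k \<in> {1..n}" and \<pi>: "\<pi> permutes {1..k - 1}"
      by (auto simp: invols_231_def)
    have "\<pi> i = i" if "k \<le> i" for i using permutes_not_in[OF \<pi>] that x(2) by auto
    with x show ?case by (auto simp: append_reversal_def fun_eq_iff)
  next
    case (4 x)
    then show ?case using append_reversal_in_invols_231 by auto
  next
    case (5 \<pi>)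
    then show ?case using append_reversal_last_block[OF 5 assms] by simp
  qed
  also have "\<dots> = (\<Sum>k\<in>{1..n}. \<Sum>\<pi>\<in>invols_231 (k - 1). w ^ fp n (append_reversal n k \<pi>))"
    by (subst sum.Sigma) (auto simp: finite_invols_231)
  also have "\<dots> = (\<Sum>k\<in>{1..n}. (if even (n + k) then w else 1) * fp_poly (k - 1) w)"
    unfolding fp_poly_def sum_distrib_left
    by (intro sum.cong refl) (simp add: fp_append_reversal)
  finally show ?thesis .
qed

lemma fp_poly_0: "fp_poly 0 w = 1"
proof -
  have "invols_231 0 = {id}" by (auto simp: invols_231_def avoids_231_def)
  then show ?thesis by (simp add: fp_poly_def fp_def)
qed

lemma fp_poly_1: "fp_poly 1 w = w"
  using fp_poly_last_block[of 1 w] by (simp add: fp_poly_0)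

lemma fp_poly_2: "fp_poly 2 w = w\<^sup>2 + 1"
proof -
  have "{1..2::nat} = {1, 2}" by auto
  then show ?thesis using fp_poly_1[of w]
    by (simp add: fp_poly_last_block[of 2] fp_poly_0 power2_eq_square)
qed

text \<open>In the expansions by the last block of \<open>P (n + 2)\<close> and \<open>P n\<close>, the terms with \<open>k \<le> n\<close> agree,
  because only the parity of \<open>n + k\<close> enters. They sum to \<open>P n\<close> only if \<open>n \<ge> 1\<close>: for \<open>n = 0\<close>
  the sum is empty whereas \<open>P 0 = 1\<close>.\<close>

lemma fp_poly_rec:
  assumes "n \<ge> 1"
  shows "fp_poly (n + 2) w = w * fp_poly (n + 1) w + 2 * fp_poly n w"
proof -
  have "fp_poly (n + 2) w =
      (\<Sum>k\<in>{1..n}. (if even (n + k) then w else 1) * fp_poly (k - 1) w) + fp_poly n w + w * fp_poly (n + 1) w"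
    by (subst fp_poly_last_block) (simp_all add: sum.atLeast_Suc_atMost_Suc_shift)
  then show ?thesis using fp_poly_last_block[OF assms, of w] by (simp add: algebra_simps)
qed


section \<open>A second order expansion\<close>

text \<open>Since \<open>f'\<close> is differentiable at \<open>c\<close>, the derivative of the second order remainder is at most
  \<open>e / 2 * norm (z - c)\<close> near \<open>c\<close>, and the mean value inequality on the segment from \<open>c\<close> to \<open>z\<close>
  gains a second factor \<open>norm (z - c)\<close>.\<close>

lemma second_order_expansion:
  fixes f f' :: "complex \<Rightarrow> complex"
  assumes S: "open S" "c \<in> S"
    and f: "\<And>z. z \<in> S \<Longrightarrow> (f has_field_derivative f' z) (at z)"
    and f': "(f' has_field_derivative f'') (at c)"
  shows "((\<lambda>z. (f z - f c - f' c * (z - c)) / (z - c)\<^sup>2) \<longlongrightarrow> f'' / 2) (at c)"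
proof (rule tendstoI)
  fix e :: real assume "e > 0"
  have "((\<lambda>z. (f' z - f' c) / (z - c)) \<longlongrightarrow> f'') (at c)"
    using f' by (simp add: has_field_derivative_iff)
  then have "eventually (\<lambda>z. dist ((f' z - f' c) / (z - c)) f'' < e / 2) (at c)"
    using \<open>e > 0\<close> by (intro tendstoD) auto
  then obtain d0 where d0: "d0 > 0"
    "\<And>z. z \<noteq> c \<Longrightarrow> dist z c < d0 \<Longrightarrow> dist ((f' z - f' c) / (z - c)) f'' < e / 2"
    unfolding eventually_at by blast
  obtain d1 where d1: "d1 > 0" "ball c d1 \<subseteq> S"
    using S openE by blast
  define g where "g z = f z - f c - f' c * (z - c) - f'' / 2 * (z - c)\<^sup>2" for z
  define d where "d = min d0 d1"
  have dg: "(g has_field_derivative (f' z - f' c - f'' * (z - c))) (at z)" if "z \<in> S" for z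
    unfolding g_def by (rule derivative_eq_intros f[OF that] refl | simp)+
  have bound: "norm (f' z - f' c - f'' * (z - c)) \<le> e / 2 * norm (z - c)" if "dist z c < d0" for z
  proof (cases "z = c")
    case False
    then have "f' z - f' c - f'' * (z - c) = ((f' z - f' c) / (z - c) - f'') * (z - c)"
      by (subst left_diff_distrib) simp
    then have "norm (f' z - f' c - f'' * (z - c)) = norm ((f' z - f' c) / (z - c) - f'') * norm (z - c)"
      by (simp only: norm_mult)
    also have "\<dots> \<le> e / 2 * norm (z - c)"
      using d0(2)[OF False that] by (intro mult_right_mono) (auto simp: dist_norm)
    finally show ?thesis .
  qed simp
  have "dist ((f z - f c - f' c * (z - c)) / (z - c)\<^sup>2) (f'' / 2) < e" if "z \<noteq> c" "dist z c < d" for z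
  proof -
    have "norm (g z - g c) \<le> e / 2 * norm (z - c) * norm (z - c)"
    proof (rule field_differentiable_bound[where S = "closed_segment c z"])
      fix x assume x: "x \<in> closed_segment c z"
      then have le: "norm (x - c) \<le> norm (z - c)"
        using segment_bound1 by (metis norm_minus_commute segment_bound(1))
      then have "dist x c < d" using that by (simp add: dist_norm)
      then have x': "x \<in> S" "dist x c < d0" using d1 by (auto simp: d_def dist_commute)
      show "(g has_field_derivative (f' x - f' c - f'' * (x - c))) (at x within closed_segment c z)"
        using dg[OF x'(1)] by (rule has_field_derivative_at_within)
      show "norm (f' x - f' c - f'' * (x - c)) \<le> e / 2 * norm (z - c)"
        using bound[OF x'(2)] le \<open>e > 0\<close>
        by (meson mult_left_mono half_gt_zero less_imp_le order_trans)
    qed auto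
    moreover have "(f z - f c - f' c * (z - c)) / (z - c)\<^sup>2 - f'' / 2 = (g z - g c) / (z - c)\<^sup>2"
      using that(1) by (simp add: g_def field_simps)
    ultimately have "dist ((f z - f c - f' c * (z - c)) / (z - c)\<^sup>2) (f'' / 2) \<le> e / 2"
      using that(1) by (simp add: dist_norm norm_divide norm_power norm_mult divide_le_eq power2_eq_square mult.assoc)
    then show ?thesis using \<open>e > 0\<close> by simp
  qed
  then show "eventually (\<lambda>z. dist ((f z - f c - f' c * (z - c)) / (z - c)\<^sup>2) (f'' / 2) < e) (at c)"
    unfolding eventually_at using d0(1) d1(1) by (intro exI[of _ d]) (auto simp: d_def)
qed

section \<open>Solving the recurrence\<close>

text \<open>The roots of \<open>x\<^sup>2 - w * x - 2\<close> are \<open>(w \<plusminus> sqrt_disc w) / 2\<close>. The principal branch of the square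
  root makes the first one dominant when \<open>w\<close> is close to the positive real axis.\<close>

definition sqrt_disc :: "complex \<Rightarrow> complex" where
  "sqrt_disc w = csqrt (w\<^sup>2 + 8)"

definition dominant_root :: "complex \<Rightarrow> complex" where
  "dominant_root w = (w + sqrt_disc w) / 2"

definition other_root :: "complex \<Rightarrow> complex" where
  "other_root w = (w - sqrt_disc w) / 2"

lemma sqrt_disc_squared: "(sqrt_disc w)\<^sup>2 = w\<^sup>2 + 8"
  by (simp add: sqrt_disc_def)

lemma roots_sum: "dominant_root w + other_root w = w"
  and roots_difference: "dominant_root w - other_root w = sqrt_disc w"
  by (simp_all add: dominant_root_def other_root_def field_simps)

lemma roots_product: "dominant_root w * other_root w = -2"
  using sqrt_disc_squared[of w]
  by (simp add: dominant_root_def other_root_def field_simps power2_eq_square)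

lemma dominant_root_nonzero: "dominant_root w \<noteq> 0"
  using roots_product[of w] by auto

lemma dominant_root_eq: "(dominant_root w)\<^sup>2 = w * dominant_root w + 2"
  and other_root_eq: "(other_root w)\<^sup>2 = w * other_root w + 2"
  using sqrt_disc_squared[of w]
  by (simp_all add: dominant_root_def other_root_def power2_eq_square field_simps)

text \<open>The recurrence, run backwards from \<open>Z 1 = w\<close> and \<open>Z 2 = w\<^sup>2 + 1\<close>, gives the initial value \<open>1 / 2\<close>
  at index 0 rather than 1. Fitting the two geometric sequences to the values \<open>1 / 2\<close> and \<open>w\<close> at
  the indices 0 and 1 yields this coefficient of the dominant one.\<close>

definition dominant_coeff :: "complex \<Rightarrow> complex" where
  "dominant_coeff w = (dominant_root w + other_root w / 2) / sqrt_disc w"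

lemma linear_recurrence_solution:
  fixes Z :: "nat \<Rightarrow> complex"
  assumes "Z 1 = w" "Z 2 = w\<^sup>2 + 1" "\<And>n. n \<ge> 1 \<Longrightarrow> Z (n + 2) = w * Z (n + 1) + 2 * Z n"
    and "sqrt_disc w \<noteq> 0" "n \<ge> 1"
  shows "Z n = dominant_coeff w * dominant_root w ^ n -
      (other_root w + dominant_root w / 2) / sqrt_disc w * other_root w ^ n"
proof -
  define A where "A = dominant_coeff w"
  define B where "B = (other_root w + dominant_root w / 2) / sqrt_disc w"
  have eq: "A - B = 1 / 2" "A * dominant_root w - B * other_root w = w"
  proof -
    show "A - B = 1 / 2" using assms(4) roots_difference[of w] by (simp add: A_def B_def dominant_coeff_def field_simps)
    have "A * dominant_root w - B * other_root w =
        ((dominant_root w + other_root w / 2) * dominant_root w - (other_root w + dominant_root w / 2) * other_root w) / sqrt_disc w"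
      by (simp add: A_def B_def dominant_coeff_def diff_divide_distrib)
    also have "(dominant_root w + other_root w / 2) * dominant_root w - (other_root w + dominant_root w / 2) * other_root w =
        (dominant_root w + other_root w) * (dominant_root w - other_root w)"
      by (simp add: algebra_simps)
    also have "\<dots> = w * sqrt_disc w" by (simp only: roots_sum roots_difference)
    finally show "A * dominant_root w - B * other_root w = w" using assms(4) by simp
  qed
  have step: "A * dominant_root w ^ (k + 2) - B * other_root w ^ (k + 2) =
      w * (A * dominant_root w ^ (k + 1) - B * other_root w ^ (k + 1)) +
      2 * (A * dominant_root w ^ k - B * other_root w ^ k)" for k
  proof -
    have "A * dominant_root w ^ (k + 2) - B * other_root w ^ (k + 2) =
        A * dominant_root w ^ k * (dominant_root w)\<^sup>2 - B * other_root w ^ k * (other_root w)\<^sup>2"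
      by (simp add: power_add power2_eq_square)
    also have "\<dots> = w * (A * dominant_root w ^ (k + 1) - B * other_root w ^ (k + 1)) +
        2 * (A * dominant_root w ^ k - B * other_root w ^ k)"
      unfolding dominant_root_eq other_root_eq by (simp add: algebra_simps)
    finally show ?thesis .
  qed
  have "Z n = A * dominant_root w ^ n - B * other_root w ^ n"
    using \<open>n \<ge> 1\<close>
  proof (induction n rule: less_induct)
    case (less n)
    consider "n = 1" | "n = 2" | k where "k \<ge> 1" "n = k + 2"
      using less.prems that(3)[of "n - 2"] by fastforce
    then show ?case
    proof cases
      case 1 then show ?thesis using eq assms(1) by simp
    next
      case 2
      have "w\<^sup>2 + 1 = w * (A * dominant_root w ^ 1 - B * other_root w ^ 1) + 2 * (A * dominant_root w ^ 0 - B * other_root w ^ 0)"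
        by (simp only: power_one_right power_0 mult_1_right eq) (simp add: power2_eq_square)
      with 2 step[of 0] assms(2) show ?thesis by (simp only: add_0_left)
    next
      case 3
      then show ?thesis using less.IH[of k] less.IH[of "k + 1"] assms(3)[of k] step[of k] by simp
    qed
  qed
  then show ?thesis by (simp add: A_def B_def)
qed

section \<open>The logarithm of the dominant root\<close>

text \<open>In this strip \<open>w\<close> has argument less than \<open>pi / 4\<close> in modulus, so \<open>w\<close> and \<open>w\<^sup>2\<close> have
  positive real part. This keeps the arguments of the square root and of the logarithm off their
  branch cut.\<close>

lemma Re_pos_in_strip:
  assumes "q > 0" "\<bar>Im z\<bar> < pi / 4"
  defines "w \<equiv> of_real q * exp z"
  shows "Re w > 0" "Re (w\<^sup>2 + 8) > 0" "Re (sqrt_disc w) > 0" "Re (dominant_root w) > 0"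
proof -
  have "cos (Im z) > 0" "cos (2 * Im z) > 0"
    using assms(2) pi_gt_zero by (auto intro!: cos_gt_zero_pi)
  show "Re w > 0" using \<open>cos (Im z) > 0\<close> assms(1) by (simp add: w_def Re_exp)
  have "w\<^sup>2 = of_real (q\<^sup>2) * exp (2 * z)"
    by (simp add: w_def power_mult_distrib exp_double)
  then show "Re (w\<^sup>2 + 8) > 0" using \<open>cos (2 * Im z) > 0\<close> assms(1) by (simp add: Re_exp add_pos_pos)
  show "Re (sqrt_disc w) > 0"
    unfolding sqrt_disc_def csqrt.sel using \<open>Re (w\<^sup>2 + 8) > 0\<close> by (simp add: add_nonneg_pos)
  with \<open>Re w > 0\<close> show "Re (dominant_root w) > 0" by (simp add: dominant_root_def)
qed

text \<open>With \<open>D = sqrt_disc w\<close> one has \<open>D' = w / D\<close>, so the dominant root \<open>(w + D) / 2\<close> has derivative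
  \<open>(D + w) / (2 * D)\<close>, the root itself divided by \<open>D\<close>. Its logarithmic derivative is therefore just
  \<open>1 / D\<close>, and \<open>w / D\<close> in the variable \<open>z\<close>, where \<open>w\<close> is its own derivative. The numerator
  of the second derivative comes from \<open>D\<^sup>2 - w\<^sup>2 = 8\<close>.\<close>

lemma Ln_dominant_root_derivatives:
  assumes "q > 0" "\<bar>Im z\<bar> < pi / 4"
  defines "w \<equiv> of_real q * exp z"
  shows "((\<lambda>z. Ln (dominant_root (of_real q * exp z))) has_field_derivative w / sqrt_disc w) (at z)"
    and "((\<lambda>z. of_real q * exp z / sqrt_disc (of_real q * exp z)) has_field_derivative
           8 * w / sqrt_disc w ^ 3) (at z)"
proof -
  note re = Re_pos_in_strip[OF assms(1,2), folded w_def]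
  have nz: "sqrt_disc w \<noteq> 0" "dominant_root w \<noteq> 0" using re by auto
  have np: "w\<^sup>2 + 8 \<notin> \<real>\<^sub>\<le>\<^sub>0" "dominant_root w \<notin> \<real>\<^sub>\<le>\<^sub>0"
    using re by (auto simp: complex_nonpos_Reals_iff)
  have dw: "((\<lambda>z. of_real q * exp z) has_field_derivative w) (at z)"
    unfolding w_def by (auto intro!: derivative_eq_intros)
  have dD: "(sqrt_disc has_field_derivative w / sqrt_disc w) (at w)"
    unfolding sqrt_disc_def using np(1) by (auto intro!: derivative_eq_intros simp: field_simps)
  have dG: "(dominant_root has_field_derivative dominant_root w / sqrt_disc w) (at w)"
    unfolding dominant_root_def
    by (rule derivative_eq_intros dD refl | use nz in \<open>simp add: field_simps\<close>)+
  have "((\<lambda>x. Ln (dominant_root x)) has_field_derivative 1 / sqrt_disc w) (at w)"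
    by (rule derivative_eq_intros dG np refl | use nz in simp)+
  from DERIV_chain2[OF this[unfolded w_def] dw]
  show "((\<lambda>z. Ln (dominant_root (of_real q * exp z))) has_field_derivative w / sqrt_disc w) (at z)"
    by (simp add: w_def)
  have "((\<lambda>x. x / sqrt_disc x) has_field_derivative 8 / sqrt_disc w ^ 3) (at w)"
    by (rule derivative_eq_intros dD refl | use nz sqrt_disc_squared[of w] in
      \<open>simp add: divide_simps power2_eq_square power3_eq_cube\<close>)+
  from DERIV_chain2[OF this[unfolded w_def] dw]
  show "((\<lambda>z. of_real q * exp z / sqrt_disc (of_real q * exp z)) has_field_derivative
           8 * w / sqrt_disc w ^ 3) (at z)"
    by (simp add: w_def)
qed

section \<open>Asymptotics of the fixed point polynomial\<close>

lemma sqrt_disc_of_real: "sqrt_disc (of_real q) = of_real (sqrt (q\<^sup>2 + 8))"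
  unfolding sqrt_disc_def by (simp flip: of_real_power of_real_add add: csqrt_of_real_nonneg)

lemma dominant_coeff_of_real_nonzero:
  assumes "q > 0"
  shows "dominant_coeff (of_real q) \<noteq> 0"
proof -
  define D where "D = sqrt (q\<^sup>2 + 8)"
  have "D > 0" unfolding D_def by (simp add: add_nonneg_pos)
  have "dominant_coeff (of_real q) = of_real ((3 * q + D) / 4 / D)"
    unfolding dominant_coeff_def dominant_root_def other_root_def sqrt_disc_of_real D_def[symmetric]
    using \<open>D > 0\<close> by (simp add: field_simps)
  moreover have "(3 * q + D) / 4 / D \<noteq> 0" using \<open>D > 0\<close> assms by simp
  ultimately show ?thesis by (simp only: of_real_eq_0_iff not_False_eq_True)
qed

lemma power_self_index_tendsto_0:
  fixes r :: "nat \<Rightarrow> complex"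
  assumes "r \<longlonglongrightarrow> l" "norm l < 1"
  shows "(\<lambda>n. r n ^ n) \<longlonglongrightarrow> 0"
proof -
  obtain \<rho> where \<rho>: "norm l < \<rho>" "\<rho> < 1" using assms(2) dense by blast
  have "eventually (\<lambda>n. norm (r n) < \<rho>) sequentially"
    using order_tendstoD(2)[OF tendsto_norm[OF assms(1)] \<rho>(1)] .
  then have "eventually (\<lambda>n. norm (r n ^ n) \<le> \<rho> ^ n) sequentially"
    by eventually_elim (simp add: norm_power power_mono)
  moreover have "(\<lambda>n. \<rho> ^ n) \<longlonglongrightarrow> 0"
    using \<rho>(2) le_less_trans[OF norm_ge_zero \<rho>(1)] by (intro LIMSEQ_power_zero) simp
  ultimately show ?thesis by (rule Lim_null_comparison)
qed

text \<open>At \<open>q\<close> the other root is negative and of smaller modulus than the dominant one. The arguments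
  \<open>w n\<close> vary with the exponent, but the quotient of the roots at \<open>w n\<close> converges to a number of
  modulus less than 1, so its \<open>n\<close>-th power still vanishes in the limit.\<close>

lemma fp_poly_asymptotics:
  assumes "q > 0" and w: "w \<longlonglongrightarrow> complex_of_real q"
  shows "(\<lambda>n. fp_poly n (w n) / dominant_root (w n) ^ n) \<longlonglongrightarrow> dominant_coeff (of_real q)"
proof -
  define D where "D = sqrt (q\<^sup>2 + 8)"
  have D: "D > q" "sqrt_disc (of_real q) = of_real D"
    using assms(1) by (auto simp: D_def sqrt_disc_of_real intro!: real_less_rsqrt)
  have nz: "sqrt_disc (of_real q) \<noteq> 0" using D assms(1) by simp
  have "(of_real q)\<^sup>2 + 8 \<notin> (\<real>\<^sub>\<le>\<^sub>0 :: complex set)"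
    by (auto simp: complex_nonpos_Reals_iff simp flip: of_real_power) (smt (verit) zero_le_power2)
  then have disc: "(\<lambda>n. sqrt_disc (w n)) \<longlonglongrightarrow> sqrt_disc (of_real q)"
    unfolding sqrt_disc_def
    by (intro isCont_tendsto_compose[OF continuous_at_csqrt] tendsto_intros w)
  have lim: "(\<lambda>n. dominant_root (w n)) \<longlonglongrightarrow> dominant_root (of_real q)"
    "(\<lambda>n. other_root (w n)) \<longlonglongrightarrow> other_root (of_real q)"
    unfolding dominant_root_def other_root_def by (intro tendsto_intros w disc; simp)+
  have cancel_halves: "(x / 2) / (y / 2) = x / y" for x y :: complex
    by simp
  have "other_root (of_real q) / dominant_root (of_real q) = of_real ((q - D) / (q + D))"
    unfolding dominant_root_def other_root_def D cancel_halves by simp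
  moreover have "\<bar>(q - D) / (q + D)\<bar> < 1"
    using D(1) assms(1) by (simp add: abs_divide divide_less_eq)
  ultimately have "norm (other_root (of_real q) / dominant_root (of_real q)) < 1"
    by (simp only: norm_of_real)
  then have pow: "(\<lambda>n. (other_root (w n) / dominant_root (w n)) ^ n) \<longlonglongrightarrow> 0"
    by (intro power_self_index_tendsto_0[OF tendsto_divide[OF lim(2,1) dominant_root_nonzero]])
  have "(\<lambda>n. dominant_coeff (w n) -
      (other_root (w n) + dominant_root (w n) / 2) / sqrt_disc (w n) * (other_root (w n) / dominant_root (w n)) ^ n)
      \<longlonglongrightarrow> dominant_coeff (of_real q) -
      (other_root (of_real q) + dominant_root (of_real q) / 2) / sqrt_disc (of_real q) * 0"
    unfolding dominant_coeff_def
    by (intro tendsto_diff tendsto_mult tendsto_divide tendsto_add tendsto_const lim disc pow nz) simp_all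
  then have main: "(\<lambda>n. dominant_coeff (w n) -
      (other_root (w n) + dominant_root (w n) / 2) / sqrt_disc (w n) * (other_root (w n) / dominant_root (w n)) ^ n)
      \<longlonglongrightarrow> dominant_coeff (of_real q)"
    by simp
  have "eventually (\<lambda>n. sqrt_disc (w n) \<noteq> 0) sequentially"
    using tendsto_imp_eventually_ne[OF disc nz] .
  then have "eventually (\<lambda>n. dominant_coeff (w n) -
      (other_root (w n) + dominant_root (w n) / 2) / sqrt_disc (w n) * (other_root (w n) / dominant_root (w n)) ^ n
      = fp_poly n (w n) / dominant_root (w n) ^ n) sequentially"
    using eventually_ge_at_top[of 1]
  proof eventually_elim
    case (elim n)
    show ?case
      using dominant_root_nonzero[of "w n"]
      by (subst linear_recurrence_solution[of "\<lambda>m. fp_poly m (w n)", OF fp_poly_1 fp_poly_2 fp_poly_rec elim])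
         (simp_all add: diff_divide_distrib power_divide)
  qed
  from Lim_transform_eventually[OF main this] show ?thesis .
qed

section \<open>Convergence to the normal distribution\<close>

lemma powr_three_halves: "x > 0 \<Longrightarrow> x powr (3 / 2) = sqrt x ^ 3" for x :: real
  by (simp add: powr_half_sqrt[symmetric] powr_power)

lemma variance_rate_pos:
  fixes q :: real
  assumes "q > 0"
  shows "8 * q / (8 + q\<^sup>2) powr (3 / 2) > 0"
proof -
  have "8 + q\<^sup>2 \<noteq> 0" using zero_le_power2[of q] by linarith
  with assms show ?thesis by simp
qed

text \<open>The scaling gives \<open>n * (\<i> * \<theta> n)\<^sup>2 = - s\<^sup>2 / v\<close>, so that \<open>n\<close> times the remainder of the first order
  expansion at 0 of the logarithm of the dominant root converges to \<open>(- s\<^sup>2 / v) * (v / 2)\<close>.\<close>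

lemma dominant_root_power_gaussian_limit:
  fixes q s :: real
  assumes "q > 0"
  defines "\<mu> \<equiv> q / sqrt (q\<^sup>2 + 8)" and "v \<equiv> 8 * q / (8 + q\<^sup>2) powr (3 / 2)"
  defines "\<theta> \<equiv> \<lambda>n. s / sqrt (v * real n)"
  shows "(\<lambda>n. exp (of_nat n * (Ln (dominant_root (of_real q * exp (\<i> * of_real (\<theta> n)))) - Ln (dominant_root (of_real q))
            - of_real \<mu> * (\<i> * of_real (\<theta> n))))) \<longlonglongrightarrow> exp (- (of_real (s\<^sup>2) / 2))"
  \<comment> \<open>The expansion concerns a punctured neighbourhood of 0, and \<open>\<theta> n = 0\<close> throughout if \<open>s = 0\<close>.\<close>
proof (cases "s = 0")
  case True
  then show ?thesis by (simp add: \<theta>_def)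
next
  case False
  define f where "f = (\<lambda>z. Ln (dominant_root (of_real q * exp z)))"
  define f' where "f' = (\<lambda>z. of_real q * exp z / sqrt_disc (of_real q * exp z))"
  define S where "S = {z. \<bar>Im z\<bar> < pi / 4}"
  have D: "sqrt (q\<^sup>2 + 8) > 0" by (simp add: add_nonneg_pos)
  have v: "v > 0" unfolding v_def by (rule variance_rate_pos[OF assms(1)])
  have v': "complex_of_real v = 8 * of_real q / sqrt_disc (of_real q) ^ 3"
    unfolding sqrt_disc_of_real v_def
    by (subst powr_three_halves) (simp_all add: add_pos_nonneg add.commute)
  have f'0: "f' 0 = of_real \<mu>" by (simp add: f'_def \<mu>_def sqrt_disc_of_real)
  have "((\<lambda>z. (f z - f 0 - f' 0 * (z - 0)) / (z - 0)\<^sup>2) \<longlongrightarrow> of_real v / 2) (at 0)"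
  proof (rule second_order_expansion)
    show "open S" unfolding S_def by (intro open_Collect_less continuous_intros)
    show "0 \<in> S" by (simp add: S_def)
    show "(f has_field_derivative f' z) (at z)" if "z \<in> S" for z
      using Ln_dominant_root_derivatives(1)[OF assms(1), of z] that by (simp add: f_def f'_def S_def)
    show "(f' has_field_derivative of_real v) (at 0)"
      using Ln_dominant_root_derivatives(2)[OF assms(1), of 0] unfolding f'_def v' by simp
  qed
  then have expansion: "((\<lambda>z. (f z - f 0 - of_real \<mu> * z) / z\<^sup>2) \<longlongrightarrow> of_real v / 2) (at 0)"
    by (simp add: f'0)
  have "\<theta> \<longlonglongrightarrow> 0"
    unfolding \<theta>_def using v by real_asymp
  then have "(\<lambda>n. \<i> * of_real (\<theta> n)) \<longlonglongrightarrow> \<i> * of_real 0"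
    by (intro tendsto_intros)
  moreover have "eventually (\<lambda>n. \<i> * of_real (\<theta> n) \<noteq> 0) sequentially"
    using eventually_gt_at_top[of 0] by eventually_elim (use False v in \<open>simp add: \<theta>_def\<close>)
  ultimately have "filterlim (\<lambda>n. \<i> * of_real (\<theta> n)) (at 0) sequentially"
    by (simp add: filterlim_at)
  from filterlim_compose[OF expansion this]
  have "(\<lambda>n. - of_real (s\<^sup>2 / v) * ((f (\<i> * of_real (\<theta> n)) - f 0 - of_real \<mu> * (\<i> * of_real (\<theta> n))) / (\<i> * of_real (\<theta> n))\<^sup>2))
      \<longlonglongrightarrow> - of_real (s\<^sup>2 / v) * (of_real v / 2)"
    by (intro tendsto_mult tendsto_const)
  moreover have "eventually (\<lambda>n. - of_real (s\<^sup>2 / v) * ((f (\<i> * of_real (\<theta> n)) - f 0 - of_real \<mu> * (\<i> * of_real (\<theta> n))) / (\<i> * of_real (\<theta> n))\<^sup>2)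
      = of_nat n * (f (\<i> * of_real (\<theta> n)) - f 0 - of_real \<mu> * (\<i> * of_real (\<theta> n)))) sequentially"
    using eventually_gt_at_top[of 0]
  proof eventually_elim
    case (elim n)
    have "(\<theta> n)\<^sup>2 = s\<^sup>2 / (v * real n)"
      using v by (simp add: \<theta>_def power_divide)
    then have "(\<i> * complex_of_real (\<theta> n))\<^sup>2 = - of_real (s\<^sup>2 / (v * real n))"
      by (simp add: power_mult_distrib flip: of_real_power)
    then show ?case using elim v False by simp
  qed
  ultimately have "(\<lambda>n. of_nat n * (f (\<i> * of_real (\<theta> n)) - f 0 - of_real \<mu> * (\<i> * of_real (\<theta> n))))
      \<longlonglongrightarrow> - of_real (s\<^sup>2 / v) * (of_real v / 2)"
    by (rule Lim_transform_eventually)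
  also have "- of_real (s\<^sup>2 / v) * (of_real v / 2) = - (complex_of_real (s\<^sup>2) / 2)"
    using v by simp
  finally show ?thesis by (auto intro!: tendsto_intros simp: f_def)
qed

text \<open>Dividing numerator and denominator by the \<open>n\<close>-th powers of their dominant roots leaves two
  factors with the same nonzero limit; the quotient of the powers, together with the centring
  factor, is the exponential of the preceding lemma.\<close>

lemma fp_char_limit:
  fixes q s :: real
  assumes "q > 0"
  defines "\<mu> \<equiv> q / sqrt (q\<^sup>2 + 8)" and "v \<equiv> 8 * q / (8 + q\<^sup>2) powr (3 / 2)"
  defines "\<theta> \<equiv> \<lambda>n. s / sqrt (v * real n)"
  shows "(\<lambda>n. exp (- (\<i> * of_real (\<theta> n * (\<mu> * real n)))) *
            fp_poly n (of_real q * exp (\<i> * of_real (\<theta> n))) / fp_poly n (of_real q))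
         \<longlonglongrightarrow> exp (- (of_real (s\<^sup>2) / 2))"
proof -
  define w where "w n = of_real q * exp (\<i> * complex_of_real (\<theta> n))" for n
  have v: "v > 0" unfolding v_def by (rule variance_rate_pos[OF assms(1)])
  have "\<theta> \<longlonglongrightarrow> 0"
    unfolding \<theta>_def using v by real_asymp
  then have "w \<longlonglongrightarrow> of_real q * exp (\<i> * of_real 0)"
    unfolding w_def by (intro tendsto_intros)
  then have w: "w \<longlonglongrightarrow> of_real q" by simp
  have "(\<lambda>n. (fp_poly n (w n) / dominant_root (w n) ^ n) / (fp_poly n (of_real q) / dominant_root (of_real q) ^ n) *
        exp (of_nat n * (Ln (dominant_root (w n)) - Ln (dominant_root (of_real q)) - of_real \<mu> * (\<i> * of_real (\<theta> n)))))
      \<longlonglongrightarrow> dominant_coeff (of_real q) / dominant_coeff (of_real q) * exp (- (of_real (s\<^sup>2) / 2))"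
    unfolding w_def \<mu>_def \<theta>_def v_def
    by (intro tendsto_mult tendsto_divide dominant_coeff_of_real_nonzero fp_poly_asymptotics tendsto_const
        dominant_root_power_gaussian_limit assms(1) w[unfolded w_def \<theta>_def v_def])
  moreover have "(fp_poly n (w n) / dominant_root (w n) ^ n) / (fp_poly n (of_real q) / dominant_root (of_real q) ^ n) *
        exp (of_nat n * (Ln (dominant_root (w n)) - Ln (dominant_root (of_real q)) - of_real \<mu> * (\<i> * of_real (\<theta> n))))
      = exp (- (\<i> * of_real (\<theta> n * (\<mu> * real n)))) * fp_poly n (w n) / fp_poly n (of_real q)" for n
  proof -
    have "exp (of_nat n * (Ln (dominant_root (w n)) - Ln (dominant_root (of_real q)) - of_real \<mu> * (\<i> * of_real (\<theta> n)))) =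
        exp (of_nat n * Ln (dominant_root (w n)) - of_nat n * Ln (dominant_root (of_real q)) + - (\<i> * of_real (\<theta> n * (\<mu> * real n))))"
      by (simp add: algebra_simps)
    also have "\<dots> = dominant_root (w n) ^ n / dominant_root (of_real q) ^ n * exp (- (\<i> * of_real (\<theta> n * (\<mu> * real n))))"
      by (simp only: exp_add exp_diff exp_of_nat_mult exp_Ln[OF dominant_root_nonzero])
    finally show ?thesis using dominant_root_nonzero by simp
  qed
  ultimately show ?thesis
    using dominant_coeff_of_real_nonzero[OF assms(1)] by (simp add: w_def)
qed

lemma char_normalised_fp:
  fixes q a b t :: real and M :: "'a measure" and X :: "'a \<Rightarrow> nat \<Rightarrow> nat"
  assumes "q > 0"
    and X: "X \<in> measurable M (count_space (avoiding_involutions n 3 \<sigma>))"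
    and distr: "distr M (count_space (avoiding_involutions n 3 \<sigma>)) X = involution_measure q n 3 \<sigma>"
    and \<sigma>: "\<sigma> \<in> {one_line [2, 3, 1], one_line [3, 1, 2]}"
  shows "char (distr M borel (\<lambda>\<omega>. (real (fp n (X \<omega>)) - a) / b)) t =
    exp (- (\<i> * of_real (t / b * a))) * fp_poly n (of_real q * exp (\<i> * of_real (t / b))) / fp_poly n (of_real q)"
proof -
  let ?A = "invols_231 n"
  define Z where "Z = (\<Sum>\<pi>\<in>?A. q ^ fp n \<pi>)"
  define g where "g \<pi> = (real (fp n \<pi>) - a) / b" for \<pi>
  note A = avoiding_involutions_eq_invols_231[OF \<sigma>, of n]
  have gm [measurable]: "g \<in> borel_measurable (count_space ?A)" by simp
  have X' [measurable]: "X \<in> measurable M (count_space ?A)" using X A by simp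
  have Z0: "Z \<ge> 0" unfolding Z_def using assms(1) by (intro sum_nonneg) simp
  have "char (distr M borel (\<lambda>\<omega>. (real (fp n (X \<omega>)) - a) / b)) t = (CLINT \<omega>|M. iexp (t * g (X \<omega>)))"
    unfolding char_def g_def[symmetric] by (rule integral_distr) measurable
  also have "\<dots> = (CLINT \<pi>|distr M (count_space ?A) X. iexp (t * g \<pi>))"
    by (rule integral_distr[symmetric]) measurable
  also have "\<dots> = (\<Sum>\<pi>\<in>?A. (q ^ fp n \<pi> / Z) *\<^sub>R iexp (t * g \<pi>))"
    unfolding distr[unfolded A] involution_measure_def A Z_def[symmetric]
    by (rule lebesgue_integral_point_measure_finite) (use finite_invols_231 Z0 assms(1) in auto)
  also have "\<dots> = (\<Sum>\<pi>\<in>?A. exp (- (\<i> * of_real (t / b * a))) *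
      (of_real q * exp (\<i> * of_real (t / b))) ^ fp n \<pi> / of_real Z)"
  proof (intro sum.cong refl)
    fix \<pi>
    have "iexp (t * g \<pi>) = exp (- (\<i> * of_real (t / b * a)) + of_nat (fp n \<pi>) * (\<i> * of_real (t / b)))"
      by (simp add: g_def algebra_simps diff_divide_distrib)
    also have "\<dots> = exp (- (\<i> * of_real (t / b * a))) * exp (\<i> * of_real (t / b)) ^ fp n \<pi>"
      by (simp only: exp_add exp_of_nat_mult)
    finally show "(q ^ fp n \<pi> / Z) *\<^sub>R iexp (t * g \<pi>) = exp (- (\<i> * of_real (t / b * a))) *
      (of_real q * exp (\<i> * of_real (t / b))) ^ fp n \<pi> / of_real Z"
      by (simp add: scaleR_conv_of_real power_mult_distrib)
  qed
  also have "\<dots> = exp (- (\<i> * of_real (t / b * a))) * fp_poly n (of_real q * exp (\<i> * of_real (t / b))) / fp_poly n (of_real q)"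
    by (simp add: fp_poly_def Z_def sum_distrib_left sum_divide_distrib)
  finally show ?thesis .
qed

text \<open>The measure at index 0 is unconstrained, whereas the continuity theorem needs every member
  of the sequence to be a distribution; dropping the first one does not affect the limit.\<close>

lemma weak_conv_m_from_Suc:
  assumes "weak_conv_m (\<lambda>n. \<nu> (Suc n)) \<mu>"
  shows "weak_conv_m \<nu> \<mu>"
  using assms unfolding weak_conv_m_def weak_conv_def by (auto intro: LIMSEQ_imp_Suc)

theorem theorem4:
  fixes q :: real and \<sigma> :: "nat \<Rightarrow> nat"
    and M :: "nat \<Rightarrow> 'a measure" and X :: "nat \<Rightarrow> 'a \<Rightarrow> (nat \<Rightarrow> nat)"
  assumes "\<sigma> \<in> {one_line [2, 3, 1], one_line [3, 1, 2]}"
    and "q > 0"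
    and "\<And>n. n \<ge> 1 \<Longrightarrow> prob_space (M n)"
    and "\<And>n. n \<ge> 1 \<Longrightarrow> X n \<in> measurable (M n) (count_space (avoiding_involutions n 3 \<sigma>))"
    and "\<And>n. n \<ge> 1 \<Longrightarrow>
           distr (M n) (count_space (avoiding_involutions n 3 \<sigma>)) (X n) = involution_measure q n 3 \<sigma>"
  shows "weak_conv_m
           (\<lambda>n. distr (M n) borel
              (\<lambda>\<omega>. (real (fp n (X n \<omega>)) - q / sqrt (q\<^sup>2 + 8) * real n)
                     / sqrt (8 * q / (8 + q\<^sup>2) powr (3 / 2) * real n)))
           std_normal_distribution"
proof (rule weak_conv_m_from_Suc, rule levy_continuity)
  let ?\<nu> = "\<lambda>n. distr (M n) borel
              (\<lambda>\<omega>. (real (fp n (X n \<omega>)) - q / sqrt (q\<^sup>2 + 8) * real n)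
                     / sqrt (8 * q / (8 + q\<^sup>2) powr (3 / 2) * real n))"
  show "real_distribution (?\<nu> (Suc n))" for n
  proof -
    interpret prob_space "M (Suc n)" by (rule assms(3)) simp
    have [measurable]: "X (Suc n) \<in> measurable (M (Suc n)) (count_space (avoiding_involutions (Suc n) 3 \<sigma>))"
      by (rule assms(4)) simp
    show ?thesis
      by (rule real_distribution_distr, rule measurable_compose[of "X (Suc n)"]) measurable
  qed
  show "real_distribution std_normal_distribution" by (rule real_dist_normal_dist)
  show "(\<lambda>n. char (?\<nu> (Suc n)) t) \<longlonglongrightarrow> char std_normal_distribution t" for t
  proof -
    have lim: "char std_normal_distribution t = exp (- (complex_of_real (t\<^sup>2) / 2))"
      by (simp add: char_std_normal_distribution exp_of_real[symmetric])
    show ?thesis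
      unfolding lim
      by (subst char_normalised_fp[OF assms(2) assms(4,5) assms(1)])
         (use LIMSEQ_Suc[OF fp_char_limit[OF assms(2), of t]] in simp_all)
  qed
qed

end
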